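(* Let $0\le m<n$ be integers. There exists a nondecreasing sequence of integers $A=(a_i)_{i\ge1}$ that is complete after every deletion of $m$ occurrences and incomplete after every deletion of $n$ occurrences if and only if $m\le1$.
   Context: For a (finite or infinite) sequence $A$ of integers (terms may be negative, zero or positive), $\mathrm{FS}(A)$ is the set of sums of finite selections of its terms, including the empty sum $0$; each occurrence (index) may be selected at most once, and repeated values count as separate occurrences. The sequence $A$ is complete if $\mathrm{FS}(A)$ contains every sufficiently large integer, and incomplete otherwise. A deletion of $r$ occurrences removes the terms at $r$ distinct indices (only the chosen occurrences are removed, not other occurrences of the same value). *)

theory Defs
  imports Main
begin

text \<open>A finite or infinite sequence is given by its terms \<open>a\<close> together with its index set \<open>I\<close>.
  Sums run over sets of indices, so repeated values count as separate occurrences.\<close>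

definition FS :: "(nat \<Rightarrow> int) \<Rightarrow> nat set \<Rightarrow> int set" where
  "FS a I = {\<Sum>i\<in>S. a i | S. finite S \<and> S \<subseteq> I}"

definition complete_seq :: "(nat \<Rightarrow> int) \<Rightarrow> nat set \<Rightarrow> bool" where
  "complete_seq a I \<longleftrightarrow> (\<exists>N. \<forall>k\<ge>N. k \<in> FS a I)"

abbreviation incomplete_seq :: "(nat \<Rightarrow> int) \<Rightarrow> nat set \<Rightarrow> bool" where
  "incomplete_seq a I \<equiv> \<not> complete_seq a I"

text \<open>The index sets that remain after removing the terms at \<open>r\<close> distinct indices. Finiteness of
  \<open>D\<close> is required explicitly because \<open>card D = 0\<close> also holds for infinite \<open>D\<close>.\<close>

definition deletions :: "nat \<Rightarrow> nat set \<Rightarrow> nat set set" where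
  "deletions r I = {I - D | D. D \<subseteq> I \<and> finite D \<and> card D = r}"

end

theory Submission
  imports Defs "HOL-Number_Theory.Fib"
begin

text \<open>
  For \<open>m = 0\<close> the powers of two work: without \<open>2 ^ (j - 1)\<close>, no number \<open>2 ^ k - 1\<close> with \<open>k \<ge> j\<close> is
  a subset sum. For \<open>m = 1\<close> the Fibonacci numbers work: they outgrow the sum of their predecessors so
  slowly that one term can be spared, but the loss of \<open>fib i\<close> and \<open>fib j\<close> with \<open>i < j\<close> makes
  \<open>fib (j + 1) - 1\<close> unreachable, and this gap reproduces itself two indices further on, for ever.

  For \<open>m \<ge> 2\<close> no sequence works, because a sequence that stays complete after every deletion of two
  terms has, for every \<open>n\<close>, some \<open>n\<close> terms whose joint deletion leaves it complete
  (\<open>complete_after_some_deletion\<close>). If the sequence is bounded it is eventually constant, and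
  finitely many copies of the constant can be dropped without any loss. Otherwise only finitely many
  terms are negative; passing to absolute values merely translates the set of subset sums
  (\<open>complete_seq_abs_iff\<close>), so that one may work with nonnegative terms tending to infinity.

  There the heart is an exchange (\<open>complete_seq_exchange\<close>). Suppose that the set \<open>D\<close> has already been
  deleted, and let \<open>F\<close> be a finite set of surviving terms whose sums contain a run that misses only
  \<open>N\<close> numbers at the bottom and \<open>C\<close> at the top of their range. If some \<open>b\<close> in \<open>F\<close> has a value of
  at least \<open>N + C\<close> plus the sum of \<open>D\<close>, then \<open>F\<close> can imitate, up to a translation by \<open>N\<close>, all sums
  of \<open>D\<close> together with \<open>F\<close> without \<open>b\<close>. Since the full sequence without \<open>b\<close> and \<open>e\<close> is
  complete, the sequence without \<open>D\<close> and \<open>e\<close> is complete for every \<open>e\<close> outside \<open>F\<close>. So one more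
  term can be deleted.

  To repeat this, the same \<open>N\<close> and \<open>C\<close> have to serve arbitrarily long initial segments \<open>F\<close>; this is
  the property \<open>solid\<close>. The original sequence is solid because one deletion is harmless
  (\<open>solid_if_one_deletable\<close>). Solidity is passed on to the sequence without a suitable \<open>e\<close>
  (\<open>solid_and_complete_delete_one\<close>): where the next term exceeds about half the sum of its
  predecessors, completeness alone yields the run by reflection, and if it eventually never does,
  then the run can be extended term by term even though \<open>e\<close> is gone.
\<close>

section \<open>Subset sums\<close>

lemma FS_I: "finite S \<Longrightarrow> S \<subseteq> I \<Longrightarrow> (\<Sum>i\<in>S. a i) \<in> FS a I"
  unfolding FS_def by blast

lemma FS_E:
  assumes "x \<in> FS a I"
  obtains S where "finite S" "S \<subseteq> I" "x = (\<Sum>i\<in>S. a i)"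
  using assms unfolding FS_def by blast

lemma FS_mono: "I \<subseteq> J \<Longrightarrow> FS a I \<subseteq> FS a J"
  unfolding FS_def by blast

lemma complete_seq_mono: "complete_seq a I \<Longrightarrow> I \<subseteq> J \<Longrightarrow> complete_seq a J"
  unfolding complete_seq_def using FS_mono by blast

lemma FS_add:
  assumes "x \<in> FS a I" "y \<in> FS a J" "I \<inter> J = {}"
  shows "x + y \<in> FS a (I \<union> J)"
proof -
  obtain S T where S: "finite S" "S \<subseteq> I" "x = (\<Sum>i\<in>S. a i)"
    and T: "finite T" "T \<subseteq> J" "y = (\<Sum>i\<in>T. a i)"
    using assms(1,2) by (elim FS_E)
  have "(\<Sum>i\<in>S \<union> T. a i) = x + y"
    using S T assms(3) by (subst sum.union_disjoint) auto
  then show ?thesis using FS_I[of "S \<union> T" "I \<union> J" a] S T by auto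
qed

lemma FS_split:
  assumes "x \<in> FS a (I \<union> J)"
  obtains y z where "y \<in> FS a I" "z \<in> FS a J" "x = y + z"
proof -
  obtain S where S: "finite S" "S \<subseteq> I \<union> J" "x = (\<Sum>i\<in>S. a i)"
    using assms by (elim FS_E)
  have "x = (\<Sum>i\<in>S \<inter> I. a i) + (\<Sum>i\<in>S - I. a i)"
    using S by (simp add: sum.Int_Diff[of S a I])
  moreover have "(\<Sum>i\<in>S \<inter> I. a i) \<in> FS a I" "(\<Sum>i\<in>S - I. a i) \<in> FS a J"
    using S by (auto intro!: FS_I)
  ultimately show ?thesis using that by blast
qed

lemma FS_reflect:
  assumes "finite F" "x \<in> FS a F"
  shows "(\<Sum>i\<in>F. a i) - x \<in> FS a F"
proof -
  obtain S where S: "finite S" "S \<subseteq> F" "x = (\<Sum>i\<in>S. a i)"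
    using assms(2) by (elim FS_E)
  then have "(\<Sum>i\<in>F - S. a i) = (\<Sum>i\<in>F. a i) - x"
    using assms(1) by (simp add: sum_diff)
  then show ?thesis using FS_I[of "F - S" F a] assms(1) by auto
qed

lemma FS_bounds:
  assumes "\<And>i. 0 \<le> w i" "finite F" "x \<in> FS w F"
  shows "0 \<le> x" "x \<le> (\<Sum>i\<in>F. w i)"
  using assms by (auto elim!: FS_E intro: sum_nonneg sum_mono2)

text \<open>A run of consecutive subset sums and its translate by a new term \<open>w i\<close> overlap or abut as
  long as the term does not exceed the length of the run.\<close>

lemma FS_interval_extend:
  fixes w :: "nat \<Rightarrow> int"
  assumes run: "{N..Y} \<subseteq> FS w F" and "i \<notin> F" and "w i + N \<le> Y + 1"
  shows "{N..Y + w i} \<subseteq> FS w (insert i F)"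
proof
  fix x assume x: "x \<in> {N..Y + w i}"
  show "x \<in> FS w (insert i F)"
  proof (cases "x \<le> Y")
    case True
    then have "x \<in> FS w F" using x run by auto
    then show ?thesis using FS_mono[of F "insert i F" w] by blast
  next
    case False
    then have "x - w i \<in> FS w F" using x assms(3) run by auto
    moreover have "w i \<in> FS w {i}" using FS_I[of "{i}" "{i}" w] by simp
    ultimately have "(x - w i) + w i \<in> FS w (F \<union> {i})"
      using assms(2) by (intro FS_add) auto
    then show ?thesis by simp
  qed
qed

text \<open>Replacing a selection by its symmetric difference with the set of all negative terms turns
  each negative term into its absolute value and shifts every sum by the same constant.\<close>

lemma complete_seq_abs_iff:
  fixes a :: "nat \<Rightarrow> int"
  assumes "finite {i. a i < 0}"
  shows "complete_seq (\<lambda>i. \<bar>a i\<bar>) J \<longleftrightarrow> complete_seq a J"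
proof -
  define M where "M = {i \<in> J. a i < 0}"
  define c where "c = (\<Sum>i\<in>M. a i)"
  have M: "finite M" "M \<subseteq> J" using assms by (auto simp: M_def)
  have flip: "(\<Sum>i\<in>sym_diff S M. a i) = (\<Sum>i\<in>S. \<bar>a i\<bar>) + c"
    if "finite S" "S \<subseteq> J" for S
  proof -
    have "(\<Sum>i\<in>sym_diff S M. a i) = (\<Sum>i\<in>S - M. a i) + (\<Sum>i\<in>M - S. a i)"
      using that M by (intro sum.union_disjoint) auto
    moreover have "c = (\<Sum>i\<in>M - S. a i) + (\<Sum>i\<in>S \<inter> M. a i)"
      using M sum.Int_Diff[of M a S] by (simp add: c_def Int_commute)
    moreover have "(\<Sum>i\<in>S. \<bar>a i\<bar>) = (\<Sum>i\<in>S \<inter> M. \<bar>a i\<bar>) + (\<Sum>i\<in>S - M. \<bar>a i\<bar>)"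
      using that by (intro sum.Int_Diff) auto
    moreover have "(\<Sum>i\<in>S \<inter> M. \<bar>a i\<bar>) = - (\<Sum>i\<in>S \<inter> M. a i)"
      unfolding sum_negf[symmetric] by (intro sum.cong) (auto simp: M_def)
    moreover have "(\<Sum>i\<in>S - M. \<bar>a i\<bar>) = (\<Sum>i\<in>S - M. a i)"
      using that by (intro sum.cong) (auto simp: M_def)
    ultimately show ?thesis by simp
  qed
  have "x \<in> FS (\<lambda>i. \<bar>a i\<bar>) J \<longleftrightarrow> x + c \<in> FS a J" for x
  proof
    assume "x \<in> FS (\<lambda>i. \<bar>a i\<bar>) J"
    then obtain S where S: "finite S" "S \<subseteq> J" "x = (\<Sum>i\<in>S. \<bar>a i\<bar>)" by (elim FS_E)
    then have "x + c = (\<Sum>i\<in>sym_diff S M. a i)" using flip by simp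
    moreover have "finite (sym_diff S M)" "sym_diff S M \<subseteq> J" using S M by auto
    ultimately show "x + c \<in> FS a J" using FS_I by simp
  next
    assume "x + c \<in> FS a J"
    then obtain S where S: "finite S" "S \<subseteq> J" "x + c = (\<Sum>i\<in>S. a i)" by (elim FS_E)
    have S': "finite (sym_diff S M)" "sym_diff S M \<subseteq> J" using S M by auto
    have "sym_diff (sym_diff S M) M = S" by blast
    then have "x = (\<Sum>i\<in>sym_diff S M. \<bar>a i\<bar>)" using flip[OF S'] S(3) by simp
    then show "x \<in> FS (\<lambda>i. \<bar>a i\<bar>) J" using FS_I[OF S'] by simp
  qed
  note shift = this
  show ?thesis
  proof
    assume "complete_seq (\<lambda>i. \<bar>a i\<bar>) J"
    then obtain N where "\<forall>k\<ge>N. k \<in> FS (\<lambda>i. \<bar>a i\<bar>) J" unfolding complete_seq_def by blast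
    then have "k - c \<in> FS (\<lambda>i. \<bar>a i\<bar>) J" if "N + c \<le> k" for k using that by auto
    then have "\<forall>k\<ge>N + c. k \<in> FS a J" using shift[of "_ - c"] by simp
    then show "complete_seq a J" unfolding complete_seq_def by blast
  next
    assume "complete_seq a J"
    then obtain N where "\<forall>k\<ge>N. k \<in> FS a J" unfolding complete_seq_def by blast
    then have "\<forall>k\<ge>N - c. k \<in> FS (\<lambda>i. \<bar>a i\<bar>) J" using shift by auto
    then show "complete_seq (\<lambda>i. \<bar>a i\<bar>) J" unfolding complete_seq_def by blast
  qed
qed

lemma cofinite_contains_tail:
  fixes J :: "nat set"
  assumes "finite (- J)"
  shows "\<exists>K. \<forall>i\<ge>K. i \<in> J"
proof -
  obtain m where "\<forall>i\<in>- J. i < m" using assms finite_nat_set_iff_bounded by blast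
  then have "\<forall>i\<ge>m. i \<in> J" by (meson ComplI not_le)
  then show ?thesis by blast
qed

section \<open>Sequences that survive every deletion of two terms\<close>

text \<open>The exchange argument. A sum \<open>x - N\<close> that avoids \<open>b\<close> and \<open>e\<close> but may use \<open>D\<close> consists of
  terms outside \<open>F\<close> and of a part \<open>q\<close> from \<open>F - {b}\<close> and \<open>D\<close>. Giving up \<open>b\<close> costs more than \<open>D\<close>
  brings in, so \<open>q + N\<close> lies in the run of sums of \<open>F\<close>; rewriting it over \<open>F\<close> represents \<open>x\<close>
  without \<open>D\<close> and without \<open>e\<close>.\<close>

lemma complete_seq_exchange:
  fixes w :: "nat \<Rightarrow> int"
  assumes nonneg: "\<And>i. 0 \<le> w i"
    and F: "finite F" "F \<subseteq> J" and D: "finite D" "D \<inter> J = {}"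
    and b: "b \<in> F" "N + C + (\<Sum>i\<in>D. w i) \<le> w b" and e: "e \<notin> F"
    and run: "{N..(\<Sum>i\<in>F. w i) - C} \<subseteq> FS w F"
    and complete: "complete_seq w (J \<union> D - {b, e})"
  shows "complete_seq w (J - {e})"
proof -
  obtain M where M: "\<And>x. M \<le> x \<Longrightarrow> x \<in> FS w (J \<union> D - {b, e})"
    using complete unfolding complete_seq_def by blast
  have "x \<in> FS w (J - {e})" if "M + N \<le> x" for x
  proof -
    have "x - N \<in> FS w (J \<union> D - {b, e})" using M that by simp
    moreover have "J \<union> D - {b, e} \<subseteq> (J - F - {e}) \<union> (F - {b} \<union> D)" by blast
    ultimately have "x - N \<in> FS w ((J - F - {e}) \<union> (F - {b} \<union> D))"
      using FS_mono by blast
    then obtain p q where p: "p \<in> FS w (J - F - {e})" and q: "q \<in> FS w (F - {b} \<union> D)"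
      and x: "x - N = p + q" by (rule FS_split)
    have "(\<Sum>i\<in>F - {b} \<union> D. w i) = (\<Sum>i\<in>F. w i) - w b + (\<Sum>i\<in>D. w i)"
      using F D b(1) by (subst sum.union_disjoint) (auto simp: sum_diff1)
    then have "q + N \<in> FS w F"
      using FS_bounds[OF nonneg _ q] F D b(2) run by auto
    then have "p + (q + N) \<in> FS w ((J - F - {e}) \<union> F)"
      using p by (intro FS_add) auto
    moreover have "(J - F - {e}) \<union> F = J - {e}" using F e by auto
    ultimately show ?thesis using x by (simp add: algebra_simps)
  qed
  then show ?thesis unfolding complete_seq_def by blast
qed

locale divergent_seq =
  fixes w :: "nat \<Rightarrow> int" and k0 :: nat
  assumes nonneg: "0 \<le> w i"
    and tail_mono: "k0 \<le> i \<Longrightarrow> i \<le> j \<Longrightarrow> w i \<le> w j"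
    and unbounded: "\<exists>i. M \<le> w i"
begin

lemma eventually_large: "\<exists>K. \<forall>i\<ge>K. M \<le> w i"
proof -
  obtain i where i: "max M (Max (insert 0 (w ` {..k0})) + 1) \<le> w i" using unbounded by blast
  have "k0 \<le> i"
  proof (rule ccontr)
    assume "\<not> k0 \<le> i"
    then have "w i \<le> Max (insert 0 (w ` {..k0}))" by (intro Max_ge) auto
    then show False using i by auto
  qed
  then show ?thesis using i tail_mono by fastforce
qed

abbreviation upto :: "nat set \<Rightarrow> nat \<Rightarrow> nat set" where
  "upto J k \<equiv> J \<inter> {..k}"

abbreviation total :: "nat set \<Rightarrow> nat \<Rightarrow> int" where
  "total J k \<equiv> (\<Sum>i\<in>upto J k. w i)"

lemma upto_Suc: "upto J (Suc k) = (if Suc k \<in> J then insert (Suc k) (upto J k) else upto J k)"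
  by (auto simp: le_Suc_eq)

text \<open>The subset sums of an initial segment fill all but a bounded part at either end of their range,
  with bounds that serve infinitely many segments.\<close>

definition solid :: "nat set \<Rightarrow> bool" where
  "solid J \<longleftrightarrow> (\<exists>N C. \<forall>K. \<exists>k\<ge>K. {N..total J k - C} \<subseteq> FS w (upto J k))"

lemma below_next_term:
  assumes "x \<in> FS w J" "x < w (Suc k)" "k0 \<le> k"
  shows "x \<in> FS w (upto J k)"
proof -
  obtain S where S: "finite S" "S \<subseteq> J" "x = (\<Sum>i\<in>S. w i)" using assms(1) by (elim FS_E)
  have "i \<le> k" if "i \<in> S" for i
  proof (rule ccontr)
    assume "\<not> i \<le> k"
    then have "w (Suc k) \<le> w i" using assms(3) by (intro tail_mono) auto
    also have "w i \<le> x" using S that nonneg by (auto intro: member_le_sum)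
    finally show False using assms(2) by simp
  qed
  then show ?thesis using S by (auto intro!: FS_I)
qed

text \<open>If the terms up to \<open>k\<close> add up to less than twice the next term, then every number in their
  range, or its reflection, lies below the next term and is therefore already a sum of them.\<close>

lemma solid_if_sparse:
  assumes complete: "complete_seq w J"
    and sparse: "\<And>K. \<exists>k\<ge>K. total J k < 2 * w (Suc k)"
  shows "solid J"
proof -
  obtain N where N: "\<And>x. N \<le> x \<Longrightarrow> x \<in> FS w J"
    using complete unfolding complete_seq_def by blast
  have "\<exists>k\<ge>K. {N..total J k - N} \<subseteq> FS w (upto J k)" for K
  proof -
    obtain k where k: "max K k0 \<le> k" "total J k < 2 * w (Suc k)" using sparse by blast
    have "x \<in> FS w (upto J k)" if x: "N \<le> x" "x \<le> total J k - N" for x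
    proof (cases "x < w (Suc k)")
      case True
      then show ?thesis using N x k by (intro below_next_term) auto
    next
      case False
      then have "total J k - x \<in> FS w (upto J k)" using N x k by (intro below_next_term) auto
      then show ?thesis using FS_reflect[of "upto J k" "total J k - x" w] by simp
    qed
    then show ?thesis using k(1) by (intro exI[of _ k]) auto
  qed
  then show ?thesis unfolding solid_def by blast
qed

text \<open>Let \<open>N\<close> be a completeness threshold. Deleting a term \<open>w i \<ge> N\<close> still leaves all large numbers
  below \<open>w (Suc k)\<close> as sums of earlier terms; adding \<open>w i\<close> back pushes the run of sums past
  \<open>w (Suc k) + N\<close>. From then on the run grows by each new term in full.\<close>

lemma solid_if_one_deletable:
  assumes cofinite: "finite (- J)"
    and complete: "complete_seq w J" and deletable: "\<And>e. e \<in> J \<Longrightarrow> complete_seq w (J - {e})"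
  shows "solid J"
proof -
  obtain N0 where N0: "\<And>x. N0 \<le> x \<Longrightarrow> x \<in> FS w J"
    using complete unfolding complete_seq_def by blast
  \<comment> \<open>A positive threshold makes the run at \<open>K\<close>, where the induction below starts, empty.\<close>
  define N where "N = max 1 N0"
  have "1 \<le> N" and N: "\<And>x. N \<le> x \<Longrightarrow> x \<in> FS w J" using N0 by (auto simp: N_def)
  obtain K1 where K1: "\<And>i. K1 \<le> i \<Longrightarrow> i \<in> J"
    using cofinite_contains_tail[OF cofinite] by blast
  obtain K2 where K2: "\<And>i. K2 \<le> i \<Longrightarrow> N \<le> w i" using eventually_large by blast
  define i where "i = max K1 K2"
  have i: "i \<in> J" "N \<le> w i" using K1 K2 by (auto simp: i_def)
  obtain N' where N': "\<And>x. N' \<le> x \<Longrightarrow> x \<in> FS w (J - {i})"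
    using deletable[OF i(1)] unfolding complete_seq_def by blast
  obtain K3 where K3: "\<And>k. K3 \<le> k \<Longrightarrow> N' + w i \<le> w k" using eventually_large by blast
  define K where "K = max (max k0 i) (max K1 K3)"
  have reach: "{N..w (Suc k) + N - 1} \<subseteq> FS w (upto J k)" if k: "K \<le> k" for k
  proof
    fix x assume x: "x \<in> {N..w (Suc k) + N - 1}"
    show "x \<in> FS w (upto J k)"
    proof (cases "x < w (Suc k)")
      case True
      then show ?thesis using N x k by (intro below_next_term) (auto simp: K_def)
    next
      case False
      have "N' + w i \<le> w (Suc k)" using K3 k by (auto simp: K_def)
      then have "x - w i \<in> FS w (upto (J - {i}) k)"
        using False x i k N' by (intro below_next_term) (auto simp: K_def)
      moreover have "w i \<in> FS w {i}" using FS_I[of "{i}" "{i}" w] by simp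
      ultimately have "(x - w i) + w i \<in> FS w (upto (J - {i}) k \<union> {i})" by (intro FS_add) auto
      moreover have "upto (J - {i}) k \<union> {i} = upto J k" using i k by (auto simp: K_def)
      ultimately show ?thesis by simp
    qed
  qed
  have run: "{N..total J k - total J K} \<subseteq> FS w (upto J k)" if "K \<le> k" for k
    using that
  proof (induction k rule: dec_induct)
    case base
    show ?case using \<open>1 \<le> N\<close> by simp
  next
    case (step k)
    \<comment> \<open>The first bound lets the run grow by \<open>w (Suc k)\<close>; the second ensures that the run is long
      enough for that.\<close>
    let ?Y = "max (total J k - total J K) (w (Suc k) + N - 1)"
    have "Suc k \<in> J" using K1 step(1) by (auto simp: K_def)
    have "{N..?Y} \<subseteq> FS w (upto J k)"
      using step.IH reach[of k] step(1) by (auto simp: max_def)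
    then have extended: "{N..?Y + w (Suc k)} \<subseteq> FS w (insert (Suc k) (upto J k))"
      by (rule FS_interval_extend) auto
    have total: "total J (Suc k) = total J k + w (Suc k)"
      using \<open>Suc k \<in> J\<close> by (simp add: upto_Suc)
    have next_upto: "upto J (Suc k) = insert (Suc k) (upto J k)"
      using \<open>Suc k \<in> J\<close> by (simp add: upto_Suc)
    have "{N..total J (Suc k) - total J K} \<subseteq> {N..?Y + w (Suc k)}"
      unfolding total by auto
    then show ?case unfolding next_upto using extended by (rule subset_trans)
  qed
  have "\<exists>k\<ge>L. {N..total J k - total J K} \<subseteq> FS w (upto J k)" for L
    using run[of "max L K"] by (intro exI[of _ "max L K"]) auto
  then show ?thesis unfolding solid_def by blast
qed

text \<open>The exchange makes every \<open>J - {e}\<close> with \<open>e\<close> beyond a suitable segment complete; the choice of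
  \<open>e\<close> is left to keep the rest solid. If infinitely often the sum up to \<open>k\<close> is below
  \<open>2 * w (Suc k) + (N + C)\<close>, a term \<open>w e \<ge> N + C\<close> absorbs the excess and the sequence becomes
  sparse. Otherwise the sum up to \<open>l\<close> eventually pays for two copies of \<open>w (Suc l)\<close>: one for the
  deleted earlier term, one for extending the run by \<open>w (Suc l)\<close>.\<close>

lemma solid_and_complete_delete_one:
  assumes cofinite: "finite (- J)" and D: "finite D" "D \<inter> J = {}" and solid: "solid J"
    and deletable: "\<And>b e. b \<in> J \<Longrightarrow> e \<in> J \<Longrightarrow> b \<noteq> e \<Longrightarrow> complete_seq w (J \<union> D - {b, e})"
  shows "\<exists>e\<in>J. solid (J - {e}) \<and> complete_seq w (J - {e})"
proof -
  obtain N C where NC: "\<And>K. \<exists>k\<ge>K. {N..total J k - C} \<subseteq> FS w (upto J k)"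
    using solid unfolding solid_def by blast
  obtain K1 where K1: "\<And>i. K1 \<le> i \<Longrightarrow> i \<in> J"
    using cofinite_contains_tail[OF cofinite] by blast
  obtain K2 where K2: "\<And>i. K2 \<le> i \<Longrightarrow> N + C + (\<Sum>i\<in>D. w i) \<le> w i" using eventually_large by blast
  define b where "b = max K1 K2"
  have b: "b \<in> J" "N + C + (\<Sum>i\<in>D. w i) \<le> w b" using K1 K2 by (auto simp: b_def)
  have complete: "complete_seq w (J - {e})"
    if "b \<le> k" "{N..total J k - C} \<subseteq> FS w (upto J k)" "k < e" "e \<in> J" for k e
    using that b D deletable[of b e] nonneg
    by (intro complete_seq_exchange[where F = "upto J k" and D = D and b = b]) auto
  show ?thesis
  proof (cases "\<forall>K. \<exists>k\<ge>K. total J k < 2 * w (Suc k) + (N + C)")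
    case True
    obtain k where k: "b \<le> k" "{N..total J k - C} \<subseteq> FS w (upto J k)" using NC by blast
    obtain K where K: "\<And>i. K \<le> i \<Longrightarrow> N + C \<le> w i" using eventually_large by blast
    define e where "e = max (Suc k) (max K1 K)"
    have e: "k < e" "e \<in> J" "N + C \<le> w e" using K1 K by (auto simp: e_def)
    have "\<exists>l\<ge>L. total (J - {e}) l < 2 * w (Suc l)" for L
    proof -
      obtain l where l: "max L e \<le> l" "total J l < 2 * w (Suc l) + (N + C)" using True by blast
      have "upto (J - {e}) l = upto J l - {e}" by blast
      then have "total (J - {e}) l = total J l - w e" using l e by (simp add: sum_diff1)
      then show ?thesis using l e by auto
    qed
    then have "solid (J - {e})" using complete[OF k e(1,2)] by (intro solid_if_sparse)
    then show ?thesis using complete[OF k e(1,2)] e by blast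
  next
    case False
    then obtain K where K: "\<And>k. K \<le> k \<Longrightarrow> 2 * w (Suc k) + (N + C) \<le> total J k"
      by (auto simp: not_less)
    obtain k where k: "max (max b k0) (max K K1) \<le> k" "{N..total J k - C} \<subseteq> FS w (upto J k)"
      using NC by blast
    \<comment> \<open>Deleting the term right after a segment with a run keeps that run as the starting point.\<close>
    let ?J = "J - {Suc k}"
    have e: "Suc k \<in> J" using K1 k by auto
    have run: "{N..total ?J l - C} \<subseteq> FS w (upto ?J l)" if "Suc k \<le> l" for l
      using that
    proof (induction l rule: dec_induct)
      case base
      have "upto ?J (Suc k) = upto J k" by (auto simp: le_Suc_eq)
      then show ?case using k(2) by simp
    next
      case (step l)
      have "upto ?J l = upto J l - {Suc k}" by blast
      then have "total ?J l = total J l - w (Suc k)" using step(1) e by (simp add: sum_diff1)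
      moreover have "w (Suc k) \<le> w (Suc l)" using step(1) k by (intro tail_mono) auto
      ultimately have "w (Suc l) + N \<le> (total ?J l - C) + 1" using K[of l] step(1) k by auto
      then have "{N..(total ?J l - C) + w (Suc l)} \<subseteq> FS w (insert (Suc l) (upto ?J l))"
        using step.IH by (intro FS_interval_extend) auto
      moreover have "Suc l \<in> ?J" using step(1) k K1 by auto
      ultimately show ?case by (simp add: upto_Suc algebra_simps)
    qed
    have "\<exists>l\<ge>L. {N..total ?J l - C} \<subseteq> FS w (upto ?J l)" for L
      using run[of "max L (Suc k)"] by (intro exI[of _ "max L (Suc k)"]) auto
    then have "solid ?J" unfolding solid_def by blast
    moreover have "complete_seq w ?J" using k e by (intro complete[of k]) auto
    ultimately show ?thesis using e by blast
  qed
qed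

lemma complete_delete_many:
  assumes cofinite: "finite (- I)"
    and deletable: "\<And>i j. i \<in> I \<Longrightarrow> j \<in> I \<Longrightarrow> i \<noteq> j \<Longrightarrow> complete_seq w (I - {i, j})"
  shows "\<exists>D\<subseteq>I. finite D \<and> card D = n \<and> complete_seq w (I - D)"
proof -
  have "infinite I" using cofinite finite_compl[of I] by auto
  have one: "complete_seq w (I - {i})" if "i \<in> I" for i
  proof -
    have "infinite (I - {i})" using \<open>infinite I\<close> by simp
    then obtain j where "j \<in> I - {i}" using infinite_imp_nonempty by blast
    then have "complete_seq w (I - {i, j})" using that deletable[of i j] by simp
    then show ?thesis by (rule complete_seq_mono) auto
  qed
  obtain i where "i \<in> I" using infinite_imp_nonempty[OF \<open>infinite I\<close>] by blast
  then have complete: "complete_seq w I" by (rule complete_seq_mono[OF one]) auto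
  have "\<exists>D\<subseteq>I. finite D \<and> card D = n \<and> solid (I - D) \<and> complete_seq w (I - D)"
  proof (induction n)
    case 0
    have "solid I" using cofinite complete one by (rule solid_if_one_deletable)
    then show ?case using complete by (intro exI[of _ "{}"]) auto
  next
    case (Suc n)
    then obtain D where D: "D \<subseteq> I" "finite D" "card D = n" "solid (I - D)" by blast
    have "(I - D) \<union> D = I" using D(1) by blast
    moreover have "finite (- (I - D))" using cofinite D(2) by (simp add: Compl_Diff_eq)
    ultimately obtain e where e: "e \<in> I - D" "solid (I - D - {e})" "complete_seq w (I - D - {e})"
      using solid_and_complete_delete_one[of "I - D" D] D(2,4) deletable by auto
    moreover have "I - insert e D = I - D - {e}" by blast
    ultimately show ?case using D by (intro exI[of _ "insert e D"]) auto
  qed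
  then show ?thesis by blast
qed

end

lemma mono_bounded_int_eventually_const:
  fixes a :: "nat \<Rightarrow> int"
  assumes mono: "mono_on {1..} a" and bounded: "\<And>i. 1 \<le> i \<Longrightarrow> a i \<le> B"
  shows "\<exists>K\<ge>1. \<forall>i\<ge>K. a i = a K"
proof -
  have "a ` {1..} \<subseteq> {a 1..B}" using bounded mono by (auto simp: mono_on_def)
  then have fin: "finite (a ` {1..})" by (rule finite_subset) simp
  have "Max (a ` {1..}) \<in> a ` {1..}" by (rule Max_in[OF fin]) auto
  then obtain K where K: "K \<ge> 1" "a K = Max (a ` {1..})" by auto
  have "a i = a K" if "i \<ge> K" for i
  proof (rule antisym)
    show "a i \<le> a K" unfolding K(2) using that K(1) by (intro Max_ge fin imageI) simp
    show "a K \<le> a i" using that K(1) by (intro mono_onD[OF mono]) auto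
  qed
  then show ?thesis using K by blast
qed

text \<open>Renaming each index \<open>i \<ge> K\<close> to \<open>i + n\<close> keeps the value of the term and avoids \<open>n\<close> indices.\<close>

lemma complete_delete_from_constant_tail:
  fixes a :: "nat \<Rightarrow> int"
  assumes K: "1 \<le> K" "\<And>i. K \<le> i \<Longrightarrow> a i = a K" and complete: "complete_seq a {1..}"
  shows "complete_seq a ({1..} - {K..<K + n})"
proof -
  define f where "f i = (if i < K then i else i + n)" for i
  have inj: "inj f" by (auto simp: f_def inj_def split: if_splits)
  have "FS a {1..} \<subseteq> FS a ({1..} - {K..<K + n})"
  proof
    fix x assume "x \<in> FS a {1..}"
    then obtain S where S: "finite S" "S \<subseteq> {1..}" "x = (\<Sum>i\<in>S. a i)" by (elim FS_E)
    have "a (f i) = a i" for i using K(2)[of i] K(2)[of "i + n"] by (simp add: f_def)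
    then have "(\<Sum>i\<in>f ` S. a i) = x"
      using S inj by (subst sum.reindex) (auto intro: inj_on_subset)
    moreover have "f ` S \<subseteq> {1..} - {K..<K + n}" using S by (auto simp: f_def)
    ultimately show "x \<in> FS a ({1..} - {K..<K + n})" 
      using S(1) FS_I[of "f ` S" _ a] by (metis finite_imageI)
  qed
  then show ?thesis using complete unfolding complete_seq_def by blast
qed

theorem complete_after_some_deletion:
  fixes a :: "nat \<Rightarrow> int"
  assumes mono: "mono_on {1..} a"
    and deletable: "\<And>i j. 1 \<le> i \<Longrightarrow> 1 \<le> j \<Longrightarrow> i \<noteq> j \<Longrightarrow> complete_seq a ({1..} - {i, j})"
  shows "\<exists>D\<subseteq>{1..}. finite D \<and> card D = n \<and> complete_seq a ({1..} - D)"
proof (cases "\<exists>B. \<forall>i\<ge>1. a i \<le> B")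
  case True
  then obtain K where K: "1 \<le> K" "\<And>i. K \<le> i \<Longrightarrow> a i = a K"
    using mono_bounded_int_eventually_const[OF mono] by blast
  have "complete_seq a {1..}"
    using deletable[of 1 2] by (rule complete_seq_mono) auto
  with K have "complete_seq a ({1..} - {K..<K + n})"
    by (intro complete_delete_from_constant_tail)
  moreover have "{K..<K + n} \<subseteq> {1..}" using K(1) by auto
  ultimately show ?thesis by (intro exI[of _ "{K..<K + n}"]) simp
next
  case False
  then have unbounded: "\<exists>i\<ge>1. M < a i" for M by (meson not_le)
  obtain k0 where k0: "1 \<le> k0" "0 < a k0" using unbounded by blast
  have tail: "0 < a i" if "k0 \<le> i" for i
    using that k0 mono_onD[OF mono, of k0 i] by auto
  have negs: "finite {i. a i < 0}"
  proof (rule finite_subset)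
    show "{i. a i < 0} \<subseteq> {..k0}" 
    proof
      fix i assume "i \<in> {i. a i < 0}"
      then have "\<not> k0 \<le> i" using tail[of i] by auto
      then show "i \<in> {..k0}" by simp
    qed
  qed simp
  note abs_iff = complete_seq_abs_iff[OF negs]
  interpret divergent_seq "\<lambda>i. \<bar>a i\<bar>" k0
  proof
    show "\<bar>a i\<bar> \<le> \<bar>a j\<bar>" if "k0 \<le> i" "i \<le> j" for i j
      using that k0 tail[of i] tail[of j] mono_onD[OF mono, of i j] by auto
    show "\<exists>i. M \<le> \<bar>a i\<bar>" for M
    proof -
      obtain i where "M < a i" using unbounded by blast
      then show ?thesis by (intro exI[of _ i]) simp
    qed
  qed auto
  have "- {1..} = {0::nat}" by auto
  then show ?thesis using complete_delete_many[of "{1..}" n] deletable by (simp add: abs_iff)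
qed

section \<open>Powers of two and Fibonacci numbers\<close>

text \<open>Brown's criterion: if no term exceeds the sum of its predecessors by more than one, the sums
  of every initial segment form a full interval.\<close>

lemma complete_seq_if_no_jump:
  fixes w :: "nat \<Rightarrow> int"
  assumes "0 \<notin> J" and unbounded: "\<And>x. \<exists>k\<in>J. x \<le> w k" and nonneg: "\<And>i. 0 \<le> w i"
    and step: "\<And>k. Suc k \<in> J \<Longrightarrow> w (Suc k) \<le> (\<Sum>i\<in>J \<inter> {..k}. w i) + 1"
  shows "complete_seq w J"
proof -
  have run: "{0..(\<Sum>i\<in>J \<inter> {..k}. w i)} \<subseteq> FS w (J \<inter> {..k})" for k
  proof (induction k)
    case 0
    have "J \<inter> {..0} = {}" using assms(1) by auto
    then show ?case using FS_I[of "{}" "{}" w] by simp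
  next
    case (Suc k)
    show ?case
    proof (cases "Suc k \<in> J")
      case True
      then have "J \<inter> {..Suc k} = insert (Suc k) (J \<inter> {..k})" by (auto simp: le_Suc_eq)
      then show ?thesis using FS_interval_extend[OF Suc, of "Suc k"] step[OF True]
        by (simp add: add.commute)
    next
      case False
      then have "J \<inter> {..Suc k} = J \<inter> {..k}" by (auto simp: le_Suc_eq)
      then show ?thesis using Suc by simp
    qed
  qed
  have "x \<in> FS w J" if "0 \<le> x" for x
  proof -
    obtain k where k: "k \<in> J" "x \<le> w k" using unbounded by blast
    have "w k \<le> (\<Sum>i\<in>J \<inter> {..k}. w i)" using k nonneg by (intro member_le_sum) auto
    then have "x \<in> FS w (J \<inter> {..k})" using run[of k] that k by auto
    then show ?thesis using FS_mono[of "J \<inter> {..k}" J w] by blast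
  qed
  then show ?thesis unfolding complete_seq_def by blast
qed

lemma sum_powers_of_two: "(\<Sum>i\<in>{1..k}. 2 ^ (i - 1)) = (2 ^ k - 1 :: int)"
  by (induction k) auto

lemma complete_powers_of_two: "complete_seq (\<lambda>i. 2 ^ (i - 1)) {1..}"
proof (rule complete_seq_if_no_jump)
  show "\<exists>k\<in>{1..}. x \<le> 2 ^ (k - 1)" for x :: int
  proof (intro bexI)
    have "x \<le> int (nat x)" by simp
    also have "\<dots> \<le> int (2 ^ nat x)" by (simp only: of_nat_le_iff less_imp_le[OF less_exp])
    finally show "x \<le> 2 ^ (Suc (nat x) - 1)" by simp
  qed auto
  have "{1..} \<inter> {..k} = {1..k}" for k :: nat by auto
  then show "2 ^ (Suc k - 1) \<le> (\<Sum>i\<in>{1..} \<inter> {..k}. 2 ^ (i - 1)) + (1 :: int)" for k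
    by (simp add: sum_powers_of_two[simplified])
qed auto

text \<open>A sum equal to \<open>2 ^ k - 1\<close> can use only the first \<open>k\<close> terms, and it needs all of them.\<close>

lemma incomplete_powers_of_two:
  assumes "1 \<le> j" "j \<notin> J" "J \<subseteq> {1..}"
  shows "incomplete_seq (\<lambda>i. 2 ^ (i - 1)) J"
proof
  assume "complete_seq (\<lambda>i. 2 ^ (i - 1)) J"
  then obtain N where N: "\<And>x. N \<le> x \<Longrightarrow> x \<in> FS (\<lambda>i. 2 ^ (i - 1)) J"
    unfolding complete_seq_def by blast
  define k where "k = max j (nat N)"
  have "N \<le> int k" by (auto simp: k_def)
  also have "int k < 2 ^ k" using less_exp[of k] by (metis of_nat_less_iff of_nat_numeral of_nat_power)
  finally have "2 ^ k - 1 \<in> FS (\<lambda>i. 2 ^ (i - 1)) J" by (intro N) simp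
  then obtain S where S: "finite S" "S \<subseteq> J" "2 ^ k - 1 = (\<Sum>i\<in>S. 2 ^ (i - 1) :: int)" by (elim FS_E)
  have "i \<le> k" if "i \<in> S" for i
  proof (rule ccontr)
    assume "\<not> i \<le> k"
    then have "(2::int) ^ k \<le> 2 ^ (i - 1)" by (intro power_increasing) auto
    also have "\<dots> \<le> (\<Sum>i\<in>S. 2 ^ (i - 1))" using S that by (intro member_le_sum) auto
    finally show False using S by simp
  qed
  then have "S \<subseteq> {1..k} - {j}" using S assms by auto
  then have "(\<Sum>i\<in>S. 2 ^ (i - 1)) \<le> (\<Sum>i\<in>{1..k} - {j}. 2 ^ (i - 1) :: int)"
    by (intro sum_mono2) auto
  also have "\<dots> = (2 ^ k - 1) - 2 ^ (j - 1)"
    using assms by (subst sum_diff1) (auto simp: sum_powers_of_two[simplified] k_def)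
  finally show False using S by (simp add: not_le)
qed

lemma sum_fib: "(\<Sum>i\<in>{1..k}. int (fib i)) = int (fib (k + 2)) - 1"
  by (induction k) auto

lemma fib_ge: "k \<le> fib k + 1"
proof (induction k rule: fib.induct)
  case (3 n)
  have "1 \<le> fib (Suc n)" by (simp add: fib_neq_0_nat Suc_le_eq)
  moreover have "1 \<le> fib n \<or> n = 0" using fib_neq_0_nat[of n] by auto
  ultimately show ?case using 3 by auto
qed auto

lemma complete_fib_delete_one:
  assumes "1 \<le> j"
  shows "complete_seq (\<lambda>i. int (fib i)) ({1..} - {j})"
proof (rule complete_seq_if_no_jump)
  show "\<exists>k\<in>{1..} - {j}. x \<le> int (fib k)" for x
  proof (intro bexI)
    show "x \<le> int (fib (nat x + j + 1))" using fib_ge[of "nat x + j + 1"] by auto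
  qed auto
  fix k assume k: "Suc k \<in> {1..} - {j}"
  have *: "({1..} - {j}) \<inter> {..k} = {1..k} - {j}" by auto
  have "j \<le> k \<Longrightarrow> fib j \<le> fib k" by (rule fib_mono)
  moreover have "fib (Suc k) \<le> fib (k + 2)" by (rule fib_mono) auto
  ultimately show "int (fib (Suc k)) \<le> (\<Sum>i\<in>({1..} - {j}) \<inter> {..k}. int (fib i)) + 1"
    using assms unfolding * by (simp add: sum_diff1 sum_fib[simplified])
qed auto

text \<open>The terms up to \<open>fib k\<close> add up to \<open>fib (k + 2) - 1\<close>, so with two of them missing a sum equal to
  \<open>fib (k + 2) - 1\<close> has to use \<open>fib (k + 1)\<close>. Removing it leaves a representation of \<open>fib k - 1\<close>, so
  the unreachability of \<open>fib k - 1\<close> entails that of \<open>fib (k + 2) - 1\<close>. The descent ends at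
  \<open>fib (j + 1) - 1\<close>, which exceeds the sum of what remains below it.\<close>

lemma incomplete_fib_delete_two:
  assumes ij: "1 \<le> i" "i < j" and J: "J \<subseteq> {1..} - {i, j}"
  shows "incomplete_seq (\<lambda>i. int (fib i)) J"
proof
  let ?w = "\<lambda>i. int (fib i)"
  have pos: "0 < fib i" "0 < fib j" using ij by (auto simp: fib_neq_0_nat)
  have small: "k \<in> {1..<l}" if "finite S" "S \<subseteq> J" "k \<in> S" "(\<Sum>k\<in>S. ?w k) = ?w l - 1" for S k l
  proof -
    have "?w k \<le> (\<Sum>k\<in>S. ?w k)" using that by (intro member_le_sum) auto
    then have "fib k < fib l" using that(4) by auto
    then have "k < l" using fib_mono[of l k] by (meson not_le)
    then show ?thesis using that J by auto
  qed
  have missing: "?w (j + 1 + 2 * t) - 1 \<notin> FS ?w J" for t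
  proof (induction t)
    case 0
    show ?case
    proof
      assume "?w (j + 1 + 2 * 0) - 1 \<in> FS ?w J"
      then obtain S where S: "finite S" "S \<subseteq> J" "?w (j + 1) - 1 = (\<Sum>k\<in>S. ?w k)"
        by (elim FS_E) simp
      have "S \<subseteq> {1..j} - {i, j}" using small[OF S(1,2) _ S(3)[symmetric]] S(2) J by fastforce
      then have "(\<Sum>k\<in>S. ?w k) \<le> (\<Sum>k\<in>{1..j} - {i, j}. ?w k)" by (intro sum_mono2) auto
      also have "\<dots> = ?w (j + 2) - 1 - ?w i - ?w j"
        using ij by (subst sum_diff) (auto simp: sum_fib[simplified])
      finally show False using S(3) pos by simp
    qed
  next
    case (Suc t)
    let ?k = "j + 1 + 2 * t"
    show ?case
    proof
      assume "?w (j + 1 + 2 * Suc t) - 1 \<in> FS ?w J"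
      then obtain S where S: "finite S" "S \<subseteq> J" "?w (?k + 2) - 1 = (\<Sum>k\<in>S. ?w k)"
        by (elim FS_E) simp
      have sub: "S \<subseteq> {1..?k + 1} - {i, j}"
        using small[OF S(1,2) _ S(3)[symmetric]] S(2) J by fastforce
      show False
      proof (cases "?k + 1 \<in> S")
        case True
        then have "(\<Sum>k\<in>S - {?k + 1}. ?w k) = ?w ?k - 1" using S by (simp add: sum_diff1)
        then show False using Suc FS_I[of "S - {?k + 1}" J ?w] S by auto
      next
        case False
        then have "S \<subseteq> {1..?k} - {i, j}" using sub by (auto simp: le_Suc_eq)
        then have "(\<Sum>k\<in>S. ?w k) \<le> (\<Sum>k\<in>{1..?k} - {i, j}. ?w k)" by (intro sum_mono2) auto
        also have "\<dots> = ?w (?k + 2) - 1 - ?w i - ?w j"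
          using ij by (subst sum_diff) (auto simp: sum_fib[simplified])
        finally show False using S(3) pos by simp
      qed
    qed
  qed
  assume "complete_seq ?w J"
  then obtain N where N: "\<And>x. N \<le> x \<Longrightarrow> x \<in> FS ?w J" unfolding complete_seq_def by blast
  define l where "l = j + 1 + 2 * (nat N + 1)"
  have "nat N + 2 \<le> fib l + 1" using fib_ge[of l] by (simp add: l_def)
  then have "N \<le> ?w l - 1" by linarith
  then have "?w l - 1 \<in> FS ?w J" by (rule N)
  then show False using missing[of "nat N + 1"] unfolding l_def by contradiction
qed

section \<open>The characterization\<close>

lemma deletions_I: "D \<subseteq> I \<Longrightarrow> finite D \<Longrightarrow> I - D \<in> deletions (card D) I"
  unfolding deletions_def by blast

lemma deletions_E:
  assumes "J \<in> deletions r I"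
  obtains D where "D \<subseteq> I" "finite D" "card D = r" "J = I - D"
  using assms unfolding deletions_def by blast

theorem theorem1:
  fixes m n :: nat
  assumes "m < n"
  shows "(\<exists>a :: nat \<Rightarrow> int. mono_on {1..} a \<and>
            (\<forall>J \<in> deletions m {1..}. complete_seq a J) \<and>
            (\<forall>J \<in> deletions n {1..}. incomplete_seq a J))
         \<longleftrightarrow> m \<le> 1"
proof
  assume "\<exists>a :: nat \<Rightarrow> int. mono_on {1..} a \<and>
            (\<forall>J \<in> deletions m {1..}. complete_seq a J) \<and>
            (\<forall>J \<in> deletions n {1..}. incomplete_seq a J)"
  then obtain a :: "nat \<Rightarrow> int" where mono: "mono_on {1..} a"
    and complete: "\<And>J. J \<in> deletions m {1..} \<Longrightarrow> complete_seq a J"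
    and incomplete: "\<And>J. J \<in> deletions n {1..} \<Longrightarrow> incomplete_seq a J" by blast
  show "m \<le> 1"
  proof (rule ccontr)
    assume m: "\<not> m \<le> 1"
    have two: "complete_seq a ({1..} - {i, j})" if "1 \<le> i" "1 \<le> j" "i \<noteq> j" for i j
    proof -
      \<comment> \<open>Pad the pair with further indices to a deletion of exactly \<open>m\<close> terms.\<close>
      define D where "D = {i, j} \<union> {Suc (i + j)..<Suc (i + j) + (m - 2)}"
      have "card D = card {i, j} + card {Suc (i + j)..<Suc (i + j) + (m - 2)}"
        unfolding D_def by (intro card_Un_disjoint) auto
      then have "card D = m" using that m by simp
      moreover have "finite D" "D \<subseteq> {1..}" using that by (auto simp: D_def)
      ultimately have "complete_seq a ({1..} - D)" using deletions_I[of D] complete by simp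
      then show ?thesis by (rule complete_seq_mono) (auto simp: D_def)
    qed
    have "\<exists>D\<subseteq>{1..}. finite D \<and> card D = n \<and> complete_seq a ({1..} - D)"
      by (rule complete_after_some_deletion[OF mono]) (rule two)
    then obtain D where D: "D \<subseteq> {1..}" "finite D" "card D = n" "complete_seq a ({1..} - D)"
      by blast
    then have "{1..} - D \<in> deletions n {1..}" using deletions_I[of D] by simp
    then show False using incomplete D(4) by simp
  qed
next
  assume "m \<le> 1"
  then consider "m = 0" | "m = 1" by linarith
  then show "\<exists>a :: nat \<Rightarrow> int. mono_on {1..} a \<and>
            (\<forall>J \<in> deletions m {1..}. complete_seq a J) \<and>
            (\<forall>J \<in> deletions n {1..}. incomplete_seq a J)"
  proof cases
    case 1
    have "incomplete_seq (\<lambda>i. 2 ^ (i - 1)) J" if J: "J \<in> deletions n {1..}" for J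
    proof -
      obtain D where D: "D \<subseteq> {1..}" "finite D" "card D = n" "J = {1..} - D"
        using J by (rule deletions_E)
      have "D \<noteq> {}" using D(3) assms by auto
      then obtain j where "j \<in> D" by blast
      then show ?thesis using D by (intro incomplete_powers_of_two[of j]) auto
    qed
    moreover have "mono_on {1..} (\<lambda>i. 2 ^ (i - 1) :: int)"
      by (auto simp: mono_on_def intro: power_increasing)
    moreover have "complete_seq (\<lambda>i. 2 ^ (i - 1)) J" if J: "J \<in> deletions m {1..}" for J
    proof -
      obtain D where "D \<subseteq> {1..}" "finite D" "card D = 0" "J = {1..} - D"
        using J[unfolded 1] by (rule deletions_E)
      then show ?thesis using complete_powers_of_two by simp
    qed
    ultimately show ?thesis by blast
  next
    case 2
    have "incomplete_seq (\<lambda>i. int (fib i)) J" if J: "J \<in> deletions n {1..}" for J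
    proof -
      obtain D where D: "D \<subseteq> {1..}" "finite D" "card D = n" "J = {1..} - D"
        using J by (rule deletions_E)
      have "2 \<le> card D" using D assms 2 by simp
      then obtain T where T: "T \<subseteq> D" "card T = 2" by (rule obtain_subset_with_card_n)
      then obtain i j where "T = {i, j}" "i < j"
        by (metis card_2_iff insert_commute nat_neq_iff)
      with T have "i \<in> D" "j \<in> D" "i < j" by auto
      then show ?thesis using D by (intro incomplete_fib_delete_two[of i j]) auto
    qed
    moreover have "mono_on {1..} (\<lambda>i. int (fib i))"
      by (auto simp: mono_on_def intro: fib_mono)
    moreover have "complete_seq (\<lambda>i. int (fib i)) J" if J: "J \<in> deletions m {1..}" for J
    proof -
      obtain D where D: "D \<subseteq> {1..}" "finite D" "card D = 1" "J = {1..} - D"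
        using J[unfolded 2] by (rule deletions_E)
      obtain j where "D = {j}" using D(3) by (rule card_1_singletonE)
      then show ?thesis using D complete_fib_delete_one[of j] by simp
    qed
    ultimately show ?thesis by blast
  qed
qed

end
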